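(* For $n\ge 1$ and $0\le p\le n-1$, let $X_{n,p}$ be the number of configurations of size $n$ in which exactly $p$ of the other $n-1$ pairs are excluded by the given pair. Then $$X(y,z):=\sum_{n\ge1}\sum_{p=0}^{n-1} X_{n,p}\,y^p\,\frac{z^n}{n!}=\frac{1}{(1-y)\sqrt{1-2z}}\tan^{-1}\frac{(1-y)z}{\sqrt{(1-2z)(1-2yz)}}.$$
   Context: Fix $n\ge1$. A configuration (of size $n$) is a perfect matching of the $2n$ points $1,2,\dots,2n$ (laid out on a line) into $n$ unordered pairs, together with one distinguished pair, called the given pair; the other $n-1$ pairs are treated as indistinguishable, so there are $n\,(2n-1)!!$ configurations. Let the given pair be $\{g<h\}$ and let $\{a<b\}$ be another pair. The pair $\{a,b\}$ is excluded by the given pair if $b<g$ or $a>h$ (both endpoints to the left, or both to the right, of the given pair). *)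

theory Defs
  imports Complex_Main
    "HOL-Library.Disjoint_Sets"
    "HOL-Computational_Algebra.Computational_Algebra"
begin

definition perfect_matchings :: "'a set \<Rightarrow> 'a set set set" where
  "perfect_matchings V = {M. partition_on V M \<and> (\<forall>e\<in>M. card e = 2)}"

text \<open>A configuration \<open>(M, G)\<close> is a matching \<open>M\<close> together with its given pair \<open>G\<close>.\<close>
definition configurations :: "nat \<Rightarrow> (nat set set \<times> nat set) set" where
  "configurations n = {(M, G). M \<in> perfect_matchings {1..2 * n} \<and> G \<in> M}"

text \<open>For \<open>G = {g < h}\<close> and \<open>P = {a < b}\<close> this reads \<open>b < g \<or> a > h\<close>.\<close>
definition excluded_by :: "nat set \<Rightarrow> nat set \<Rightarrow> bool" where
  "excluded_by G P \<longleftrightarrow> Max P < Min G \<or> Min P > Max G"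

definition num_excluded :: "nat set set \<times> nat set \<Rightarrow> nat" where
  "num_excluded = (\<lambda>(M, G). card {P \<in> M - {G}. excluded_by G P})"

definition X_count :: "nat \<Rightarrow> nat \<Rightarrow> nat" where
  "X_count n p = card {c \<in> configurations n. num_excluded c = p}"

text \<open>
  The generating function as a formal power series in \<open>z\<close>. The parameter \<open>y\<close> is an arbitrary
  element of a field of characteristic 0; taking it to be transcendental, e.g. the variable of
  the field of rational functions (see the lemma at the end), makes it an indeterminate.
\<close>
definition X_gf :: "'a::field_char_0 \<Rightarrow> 'a fps" where
  "X_gf y = Abs_fps (\<lambda>n. if n = 0 then 0
     else (\<Sum>p = 0..n - 1. of_nat (X_count n p) * y ^ p) / fact n)"

text \<open>
  The square root with constant coefficient 1 of a series with constant coefficient 1; the first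
  argument of \<^const>\<open>fps_radical\<close> chooses the root of the constant coefficient.
\<close>
definition fps_sqrt1 :: "'a::field_char_0 fps \<Rightarrow> 'a fps" where
  "fps_sqrt1 f = fps_radical (\<lambda>_ _. 1) 2 f"

text \<open>\<^const>\<open>fps_inv\<close> is the inverse with respect to composition.\<close>
definition fps_arctan :: "'a::field_char_0 fps" where
  "fps_arctan = fps_inv (fps_tan 1)"

lemma fps_sqrt1_power2:
  assumes "fps_nth f 0 = 1"
  shows "fps_sqrt1 f ^ 2 = f"
  using power_radical[of f "\<lambda>_ _. 1" 1] assms
  by (simp add: fps_sqrt1_def numeral_2_eq_2)

lemma fps_sqrt1_nth_0: "fps_nth (fps_sqrt1 f) 0 = 1"
  by (simp add: fps_sqrt1_def)

lemma fps_tan_compose_arctan: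
  "fps_tan (1::'a::field_char_0) oo fps_arctan = fps_X"
  "fps_arctan oo fps_tan (1::'a) = fps_X"
proof -
  have "fps_nth (fps_tan (1::'a)) 0 = 0"
    by (simp add: fps_tan_def fps_sin_def fps_cos_def fps_divide_unit)
  moreover have "fps_nth (fps_tan (1::'a)) 1 \<noteq> 0"
    by (simp add: fps_tan_def fps_divide_unit fps_sin_def fps_cos_def fps_mult_nth_1)
  ultimately show "fps_tan (1::'a) oo fps_arctan = fps_X" "fps_arctan oo fps_tan (1::'a) = fps_X"
    unfolding fps_arctan_def by (rule fps_inv_right, rule fps_inv)
qed

lemma indeterminate_neq_1: "to_fract [:0, 1 :: rat:] \<noteq> (1 :: rat poly fract)"
  by (metis one_pCons pCons_eq_iff to_fract_1 to_fract_eq_iff zero_neq_one)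

end

theory Submission
  imports Defs
begin

text \<open>
  A pair is excluded iff both its points lie left of, or both lie right of, the given pair. Let
  \<open>w a b c\<close> be the sum of \<open>y ^ p\<close> over the matchings of \<open>a\<close> points to the left, \<open>b\<close> between and
  \<open>c\<close> to the right, where \<open>p\<close> is the number of excluded pairs. Removing one point with its partner
  gives recurrences for \<open>w\<close>. Let \<open>x n\<close> be the sum of \<open>w a b c\<close> over \<open>a + b + c = 2 * n\<close>, and
  \<open>c n\<close> the part of it with \<open>b = 0\<close>; then \<open>x (n + 1) = (2 * n + 3) * x n + c (n + 1)\<close> and
  \<open>c (n + 1) = (n + 1) * (1 + y) * c n + y ^ (n + 1) * (2 * n + 1)!!\<close>. The coefficient of
  \<open>z ^ (n + 1) / (n + 1)!\<close> in the generating function \<open>F\<close> is \<open>x n\<close>, so these recurrences say that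
  \<open>sqrt (1 - 2 y z) * (1 - (1 + y) z) * ((1 - 2 z) * F' - F) = 1\<close>. The closed form satisfies this
  equation too, and a solution is determined by its constant coefficient.
\<close>

section \<open>Perfect matchings: removing and adding one pair\<close>

lemma perfect_matchings_Diff:
  assumes "M \<in> perfect_matchings V" "G \<in> M"
  shows "M - {G} \<in> perfect_matchings (V - G)" "G \<subseteq> V" "card G = 2"
proof -
  have M: "\<Union>M = V" "disjoint M" "{} \<notin> M" "\<And>e. e \<in> M \<Longrightarrow> card e = 2"
    using assms by (auto simp: perfect_matchings_def partition_on_def)
  have "\<Union>(M - {G}) = V - G"
    using M(1,2) assms(2) by (fastforce simp: disjoint_def)
  moreover have "disjoint (M - {G})"
    using M(2) by (auto simp: disjoint_def)
  ultimately show "M - {G} \<in> perfect_matchings (V - G)"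
    using M by (auto simp: perfect_matchings_def partition_on_def)
  show "G \<subseteq> V" "card G = 2"
    using M assms(2) by auto
qed

lemma perfect_matchings_insert:
  assumes "M \<in> perfect_matchings (V - G)" "G \<subseteq> V" "card G = 2"
  shows "insert G M \<in> perfect_matchings V" "G \<notin> M"
proof -
  have M: "\<Union>M = V - G" "disjoint M" "{} \<notin> M" "\<And>e. e \<in> M \<Longrightarrow> card e = 2"
    using assms by (auto simp: perfect_matchings_def partition_on_def)
  have G: "G \<noteq> {}" using assms(3) by auto
  have "disjoint (insert G M)"
    using M(1,2) unfolding disjoint_def by blast
  then show "insert G M \<in> perfect_matchings V"
    using M G assms by (auto simp: perfect_matchings_def partition_on_def)
  show "G \<notin> M"
    using M(1) G by blast
qed

lemma perfect_matchings_empty: "perfect_matchings {} = {{}}"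
  by (auto simp: perfect_matchings_def partition_on_def)

lemma finite_perfect_matchings:
  assumes "finite V"
  shows "finite (perfect_matchings V)"
proof (rule finite_subset)
  show "perfect_matchings V \<subseteq> Pow (Pow V)"
    by (auto simp: perfect_matchings_def partition_on_def)
qed (use assms in simp)

lemma perfect_matching_finite:
  assumes "finite V" "M \<in> perfect_matchings V"
  shows "finite M"
  using assms by (auto simp: perfect_matchings_def partition_on_def intro: finite_UnionD)

lemma card_perfect_matching:
  assumes "finite V" "M \<in> perfect_matchings V"
  shows "2 * card M = card V"
proof -
  have M: "\<Union>M = V" "disjoint M" "\<And>e. e \<in> M \<Longrightarrow> card e = 2"
    using assms by (auto simp: perfect_matchings_def partition_on_def)
  have "card (\<Union>M) = sum card M"
    by (rule card_Union_disjoint)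
      (use M in \<open>auto simp: disjoint_def pairwise_def disjnt_def intro: card_ge_0_finite\<close>)
  then show ?thesis using M by simp
qed

text \<open>The point \<open>v\<close> has exactly one partner \<open>u\<close>, and deleting their
  pair leaves a perfect matching of the other points. This is a bijection, so a sum over matchings
  splits according to the partner of \<open>v\<close>.\<close>

lemma sum_perfect_matchings:
  assumes "v \<in> V"
  shows "(\<Sum>M\<in>perfect_matchings V. f M) =
    (\<Sum>(u, M)\<in>(SIGMA u:V - {v}. perfect_matchings (V - {u, v})). f (insert {u, v} M))"
proof -
  let ?S = "SIGMA u:V - {v}. perfect_matchings (V - {u, v})"
  have ins: "insert {u, v} M \<in> perfect_matchings V" "{u, v} \<notin> M" "v \<notin> \<Union>M"
    if "u \<in> V - {v}" "M \<in> perfect_matchings (V - {u, v})" for u M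
  proof -
    have "{u, v} \<subseteq> V" "card {u, v} = 2"
      using that(1) assms by auto
    then show "insert {u, v} M \<in> perfect_matchings V" "{u, v} \<notin> M"
      by (rule perfect_matchings_insert[OF that(2)])+
    show "v \<notin> \<Union>M"
      using that(2) by (simp add: perfect_matchings_def partition_on_def)
  qed
  have "bij_betw (\<lambda>(u, M). insert {u, v} M) ?S (perfect_matchings V)"
  proof (rule bij_betw_imageI)
    show "inj_on (\<lambda>(u, M). insert {u, v} M) ?S"
    proof (rule inj_onI)
      fix s s' assume s: "s \<in> ?S" "s' \<in> ?S"
        and e: "(\<lambda>(u, M). insert {u, v} M) s = (\<lambda>(u, M). insert {u, v} M) s'"
      obtain u M u' M' where st: "s = (u, M)" "s' = (u', M')" by (metis surj_pair)
      then have *: "u \<in> V - {v}" "M \<in> perfect_matchings (V - {u, v})"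
        "u' \<in> V - {v}" "M' \<in> perfect_matchings (V - {u', v})"
        using s by auto
      have eq: "insert {u, v} M = insert {u', v} M'"
        using e st by simp
      have i: "{u, v} \<notin> M" "{u', v} \<notin> M'" "v \<notin> \<Union>M'"
        using ins(2)[of u M] ins(2,3)[of u' M'] * by simp_all
      have "{u, v} \<in> insert {u', v} M'" using eq by (metis insertI1)
      \<comment> \<open>Since \<open>v\<close> lies in no pair of \<open>M'\<close>, the pair
        \<open>{u, v}\<close> can only be the inserted one.\<close>
      then have "{u, v} = {u', v}" using i(3) by blast
      then have "u = u'" by (auto simp: doubleton_eq_iff)
      moreover have "M = M'" using eq i(1,2) \<open>u = u'\<close> by (metis insert_ident)
      ultimately show "s = s'" by (simp add: st)
    qed
    show "(\<lambda>(u, M). insert {u, v} M) ` ?S = perfect_matchings V"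
    proof (intro equalityI subsetI)
      fix M assume "M \<in> (\<lambda>(u, M). insert {u, v} M) ` ?S"
      then show "M \<in> perfect_matchings V" using ins by auto
    next
      fix M assume M: "M \<in> perfect_matchings V"
      then obtain G where G: "G \<in> M" "v \<in> G"
        using assms by (auto simp: perfect_matchings_def partition_on_def)
      note P = perfect_matchings_Diff[OF M G(1)]
      obtain u where u: "G = {u, v}" "u \<noteq> v"
        using P(3) G(2) by (auto simp: card_2_iff)
      have "(u, M - {G}) \<in> ?S" using P u by auto
      moreover have "M = insert {u, v} (M - {G})" using G u by auto
      ultimately show "M \<in> (\<lambda>(u, M). insert {u, v} M) ` ?S"
        by (intro rev_image_eqI[of "(u, M - {G})"]) simp_all
    qed
  qed
  then have "(\<Sum>M\<in>perfect_matchings V. f M) = (\<Sum>s\<in>?S. f ((\<lambda>(u, M). insert {u, v} M) s))"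
    by (rule sum.reindex_bij_betw[symmetric])
  then show ?thesis by (simp add: case_prod_unfold)
qed

section \<open>Weighted matchings of three blocks of points\<close>

text \<open>\<open>A\<close>, \<open>B\<close>, \<open>C\<close> stand for the points to the left of, between, and to the right of the
  endpoints of the given pair.\<close>

definition matching_weight :: "'b::comm_semiring_1 \<Rightarrow> 'a set \<Rightarrow> 'a set \<Rightarrow> 'a set \<Rightarrow> 'b" where
  "matching_weight y A B C =
    (\<Sum>M\<in>perfect_matchings (A \<union> B \<union> C). y ^ card {P \<in> M. P \<subseteq> A \<or> P \<subseteq> C})"

text \<open>Split by the partner \<open>u\<close> of \<open>v\<close>. The pair
  \<open>{u, v}\<close> contributes a factor \<open>y\<close> exactly when it lies inside one outer
  block, and the remaining pairs are weighed in the shrunken blocks.\<close>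

lemma matching_weight_remove:
  assumes "finite (A \<union> B \<union> C)" "v \<in> A \<union> B \<union> C"
  shows "matching_weight y A B C =
    (\<Sum>u\<in>A \<union> B \<union> C - {v}. (if {u, v} \<subseteq> A \<or> {u, v} \<subseteq> C then y else 1) *
       matching_weight y (A - {u, v}) (B - {u, v}) (C - {u, v}))"
proof -
  let ?V = "A \<union> B \<union> C"
  have eq: "(A - {u, v}) \<union> (B - {u, v}) \<union> (C - {u, v}) = ?V - {u, v}" for u
    by blast
  have *: "y ^ card {P \<in> insert {u, v} M. P \<subseteq> A \<or> P \<subseteq> C} =
      (if {u, v} \<subseteq> A \<or> {u, v} \<subseteq> C then y else 1) *
      y ^ card {P \<in> M. P \<subseteq> A - {u, v} \<or> P \<subseteq> C - {u, v}}"
    if u: "u \<in> ?V - {v}" and M: "M \<in> perfect_matchings (?V - {u, v})" for u M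
  proof -
    have nin: "{u, v} \<notin> M"
      by (rule perfect_matchings_insert(2)[OF M]) (use u assms in auto)
    have fin: "finite M"
      by (rule perfect_matching_finite[OF _ M]) (use assms in auto)
    \<comment> \<open>The pairs of \<open>M\<close> avoid \<open>u\<close> and \<open>v\<close>, so
      shrinking the blocks does not change which of them are counted.\<close>
    have "P \<inter> {u, v} = {}" if "P \<in> M" for P
      using M that by (auto simp: perfect_matchings_def partition_on_def)
    then have sub: "{P \<in> M. P \<subseteq> A - {u, v} \<or> P \<subseteq> C - {u, v}} = {P \<in> M. P \<subseteq> A \<or> P \<subseteq> C}"
      by blast
    show ?thesis
    proof (cases "{u, v} \<subseteq> A \<or> {u, v} \<subseteq> C")
      case True
      then have "{P \<in> insert {u, v} M. P \<subseteq> A \<or> P \<subseteq> C} = insert {u, v} {P \<in> M. P \<subseteq> A \<or> P \<subseteq> C}"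
        by blast
      then show ?thesis using True nin fin by (simp add: sub)
    next
      case False
      then have "{P \<in> insert {u, v} M. P \<subseteq> A \<or> P \<subseteq> C} = {P \<in> M. P \<subseteq> A \<or> P \<subseteq> C}"
        by blast
      then show ?thesis using False by (simp only: sub) simp
    qed
  qed
  have "matching_weight y A B C =
    (\<Sum>(u, M)\<in>(SIGMA u:?V - {v}. perfect_matchings (?V - {u, v})).
      y ^ card {P \<in> insert {u, v} M. P \<subseteq> A \<or> P \<subseteq> C})"
    unfolding matching_weight_def by (rule sum_perfect_matchings[OF assms(2)])
  also have "\<dots> = (\<Sum>u\<in>?V - {v}. \<Sum>M\<in>perfect_matchings (?V - {u, v}).
      y ^ card {P \<in> insert {u, v} M. P \<subseteq> A \<or> P \<subseteq> C})"
    by (rule sum.Sigma[symmetric]) (use assms in \<open>auto intro: finite_perfect_matchings\<close>)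
  also have "\<dots> = (\<Sum>u\<in>?V - {v}. \<Sum>M\<in>perfect_matchings (?V - {u, v}).
      (if {u, v} \<subseteq> A \<or> {u, v} \<subseteq> C then y else 1) *
      y ^ card {P \<in> M. P \<subseteq> A - {u, v} \<or> P \<subseteq> C - {u, v}})"
    by (intro sum.cong refl *)
  finally show ?thesis
    by (simp only: matching_weight_def eq sum_distrib_left)
qed

lemma matching_weight_commute: "matching_weight y A B C = matching_weight y C B A"
  by (simp add: matching_weight_def Un_ac disj_commute)

text \<open>The removed point comes from the middle block if there is one, otherwise from the left,
  otherwise from the right; the summands correspond to the block of its partner. Where a truncated
  \<open>- 1\<close> would be taken at 0, the coefficient in front vanishes. An odd number of points
  gives 0, as it should.\<close>

fun three_part_weight :: "'b::comm_semiring_1 \<Rightarrow> nat \<Rightarrow> nat \<Rightarrow> nat \<Rightarrow> 'b" where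
  "three_part_weight y a (Suc b) c = of_nat b * three_part_weight y a (b - 1) c +
     of_nat a * three_part_weight y (a - 1) b c + of_nat c * three_part_weight y a b (c - 1)"
| "three_part_weight y (Suc a) 0 c = y * of_nat a * three_part_weight y (a - 1) 0 c +
     of_nat c * three_part_weight y a 0 (c - 1)"
| "three_part_weight y 0 0 (Suc c) = y * of_nat c * three_part_weight y 0 0 (c - 1)"
| "three_part_weight y 0 0 0 = 1"

text \<open>Induction on the number of points. The removed point is chosen in the same order as in
  the equations of \<open>three_part_weight\<close>, and all partners within one block give the same
  term.\<close>

lemma matching_weight_eq:
  assumes "finite A" "finite B" "finite C" "A \<inter> B = {}" "A \<inter> C = {}" "B \<inter> C = {}"
  shows "matching_weight y A B C = three_part_weight y (card A) (card B) (card C)"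
  using assms
proof (induction "card A + card B + card C" arbitrary: A B C rule: less_induct)
  case less
  note fin = less.prems(1-3) and disj = less.prems(4-6)
  let ?g = "\<lambda>v u. (if {u, v} \<subseteq> A \<or> {u, v} \<subseteq> C then y else 1) *
       matching_weight y (A - {u, v}) (B - {u, v}) (C - {u, v})"
  have IH: "matching_weight y (A - {u, v}) (B - {u, v}) (C - {u, v}) =
      three_part_weight y (card (A - {u, v})) (card (B - {u, v})) (card (C - {u, v}))"
    if v: "v \<in> A \<union> B \<union> C" for u v
  proof (rule less.hyps)
    have le: "card (S - {u, v}) \<le> card S" if "finite S" for S
      by (rule card_mono) (use that in auto)
    have lt: "card (S - {u, v}) < card S" if "finite S" "v \<in> S" for S
      by (rule psubset_card_mono) (use that in auto)
    show "card (A - {u, v}) + card (B - {u, v}) + card (C - {u, v}) < card A + card B + card C"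
    proof -
      consider "v \<in> A" | "v \<in> B" | "v \<in> C" using v by blast
      then show ?thesis
      proof cases
        case 1
        show ?thesis using le[OF fin(2)] le[OF fin(3)] lt[OF fin(1) 1] by linarith
      next
        case 2
        show ?thesis using le[OF fin(1)] le[OF fin(3)] lt[OF fin(2) 2] by linarith
      next
        case 3
        show ?thesis using le[OF fin(1)] le[OF fin(2)] lt[OF fin(3) 3] by linarith
      qed
    qed
  qed (use fin disj in auto)
  consider (B) v where "v \<in> B" | (A) v where "B = {}" "v \<in> A"
    | (C) v where "A = {}" "B = {}" "v \<in> C" | (empty) "A = {}" "B = {}" "C = {}"
    by blast
  then show ?case
  proof cases
    case B
    \<comment> \<open>No pair containing a middle point lies inside an outer block, so the factor is
      1 in all three sums.\<close>
    have nv: "v \<notin> A" "v \<notin> C" using B disj by auto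
    obtain b where b: "card B = Suc b" "card (B - {v}) = b"
      using B fin by (metis card_Suc_Diff1)
    have gA: "?g v u = three_part_weight y (card A - 1) b (card C)" if "u \<in> A" for u
    proof -
      have "A - {u, v} = A - {u}" "B - {u, v} = B - {v}" "C - {u, v} = C"
        using that nv disj by auto
      then show ?thesis using IH[of v u] B nv that fin b by simp
    qed
    have gB: "?g v u = three_part_weight y (card A) (b - 1) (card C)" if "u \<in> B - {v}" for u
    proof -
      have "A - {u, v} = A" "B - {u, v} = B - {v} - {u}" "C - {u, v} = C"
        using that nv disj by auto
      then show ?thesis using IH[of v u] B nv that fin b by simp
    qed
    have gC: "?g v u = three_part_weight y (card A) b (card C - 1)" if "u \<in> C" for u
    proof -
      have "A - {u, v} = A" "B - {u, v} = B - {v}" "C - {u, v} = C - {u}"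
        using that nv disj by auto
      then show ?thesis using IH[of v u] B nv that fin b by simp
    qed
    have "matching_weight y A B C = sum (?g v) (A \<union> B \<union> C - {v})"
      by (rule matching_weight_remove) (use fin B in auto)
    also have "A \<union> B \<union> C - {v} = (A \<union> (B - {v})) \<union> C"
      using nv by auto
    also have "sum (?g v) \<dots> = sum (?g v) A + sum (?g v) (B - {v}) + sum (?g v) C"
      by (subst sum.union_disjoint, use fin disj in \<open>auto\<close>)+
    also have "\<dots> = (\<Sum>u\<in>A. three_part_weight y (card A - 1) b (card C)) +
        (\<Sum>u\<in>B - {v}. three_part_weight y (card A) (b - 1) (card C)) +
        (\<Sum>u\<in>C. three_part_weight y (card A) b (card C - 1))"
      by (intro arg_cong2[where f = "(+)"] sum.cong refl gA gB gC)
    finally show ?thesis by (simp only: b sum_constant three_part_weight.simps) (simp add: ac_simps)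
  next
    case A
    have nv: "v \<notin> C" using A disj by auto
    obtain a where a: "card A = Suc a" "card (A - {v}) = a"
      using A fin by (metis card_Suc_Diff1)
    have gA: "?g v u = y * three_part_weight y (a - 1) 0 (card C)" if "u \<in> A - {v}" for u
    proof -
      have "A - {u, v} = A - {v} - {u}" "C - {u, v} = C"
        using that nv disj by auto
      then show ?thesis using IH[of v u] A nv that fin a by simp
    qed
    have gC: "?g v u = three_part_weight y a 0 (card C - 1)" if "u \<in> C" for u
    proof -
      have "A - {u, v} = A - {v}" "C - {u, v} = C - {u}" "u \<notin> A"
        using that nv disj by auto
      then show ?thesis using IH[of v u] A nv that fin a by simp
    qed
    have "matching_weight y A B C = sum (?g v) (A \<union> B \<union> C - {v})"
      by (rule matching_weight_remove) (use fin A in auto)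
    also have "A \<union> B \<union> C - {v} = (A - {v}) \<union> C"
      using nv A by auto
    also have "sum (?g v) \<dots> = sum (?g v) (A - {v}) + sum (?g v) C"
      by (subst sum.union_disjoint) (use fin disj in auto)
    also have "\<dots> = (\<Sum>u\<in>A - {v}. y * three_part_weight y (a - 1) 0 (card C)) +
        (\<Sum>u\<in>C. three_part_weight y a 0 (card C - 1))"
      by (intro arg_cong2[where f = "(+)"] sum.cong refl gA gC)
    finally show ?thesis using A(1)
      by (simp only: a sum_constant card.empty three_part_weight.simps) (simp add: ac_simps)
  next
    case C
    obtain c where c: "card C = Suc c" "card (C - {v}) = c"
      using C fin by (metis card_Suc_Diff1)
    have gC: "?g v u = y * three_part_weight y 0 0 (c - 1)" if "u \<in> C - {v}" for u
    proof -
      have "C - {u, v} = C - {v} - {u}" by auto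
      then show ?thesis using IH[of v u] C that fin c by simp
    qed
    have "matching_weight y A B C = sum (?g v) (A \<union> B \<union> C - {v})"
      by (rule matching_weight_remove) (use fin C in auto)
    also have "A \<union> B \<union> C - {v} = C - {v}"
      using C by auto
    also have "sum (?g v) \<dots> = (\<Sum>u\<in>C - {v}. y * three_part_weight y 0 0 (c - 1))"
      by (intro sum.cong refl gC)
    finally show ?thesis using C(1,2)
      by (simp only: c sum_constant card.empty three_part_weight.simps) (simp add: ac_simps)
  next
    case empty
    then show ?thesis by (simp add: matching_weight_def perfect_matchings_empty)
  qed
qed

text \<open>The recursion treats left and right differently, so the symmetry is read off from
  matchings: both sides are weights of the same three intervals, with the outer two
  exchanged.\<close>

lemma three_part_weight_commute: "three_part_weight y a b c = three_part_weight y c b a"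
proof -
  have 1: "matching_weight y {..<a} {a..<a + b} {a + b..<a + b + c} = three_part_weight y a b c"
    by (subst matching_weight_eq) auto
  have 2: "matching_weight y {a + b..<a + b + c} {a..<a + b} {..<a} = three_part_weight y c b a"
    by (subst matching_weight_eq) auto
  show ?thesis using 1 2 matching_weight_commute by metis
qed

section \<open>From configurations to sums over block sizes\<close>

definition compositions3 :: "nat \<Rightarrow> (nat \<times> nat \<times> nat) set" where
  "compositions3 N = {(a, b, c). a + b + c = N}"

lemma finite_compositions3: "finite (compositions3 N)"
proof (rule finite_subset)
  show "compositions3 N \<subseteq> {..N} \<times> {..N} \<times> {..N}"
    by (auto simp: compositions3_def)
qed simp

text \<open>The given pair is determined by the numbers of points to its left, inside and to its
  right, which add up to \<open>2 * n - 2\<close>. The other pairs form an arbitrary perfect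
  matching of the remaining points.\<close>

lemma sum_power_num_excluded:
  assumes "n \<ge> 1"
  shows "(\<Sum>c\<in>configurations n. y ^ num_excluded c) =
    (\<Sum>(a, b, c)\<in>compositions3 (2 * n - 2). three_part_weight y a b c)"
proof -
  let ?V = "{1..2 * n}"
  let ?T = "compositions3 (2 * n - 2)"
  \<comment> \<open>With \<open>a\<close> points before the first endpoint and \<open>b\<close>
    between the two, the endpoints are \<open>a + 1\<close> and \<open>a + b + 2\<close>.\<close>
  let ?G = "\<lambda>(a, b, c::nat). {Suc a, a + b + 2}"
  let ?S = "SIGMA t:?T. perfect_matchings (?V - ?G t)"
  have G: "?G t \<subseteq> ?V" "card (?G t) = 2" if "t \<in> ?T" for t
    using that assms by (auto simp: compositions3_def)
  have "bij_betw (\<lambda>(t, M). (insert (?G t) M, ?G t)) ?S (configurations n)"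
  proof (rule bij_betw_imageI)
    show "inj_on (\<lambda>(t, M). (insert (?G t) M, ?G t)) ?S"
    proof (rule inj_onI)
      fix s s' assume s: "s \<in> ?S" "s' \<in> ?S"
        and e: "(\<lambda>(t, M). (insert (?G t) M, ?G t)) s = (\<lambda>(t, M). (insert (?G t) M, ?G t)) s'"
      obtain t M t' M' where st: "s = (t, M)" "s' = (t', M')" by (metis surj_pair)
      then have t: "t \<in> ?T" "t' \<in> ?T" and M: "M \<in> perfect_matchings (?V - ?G t)"
        "M' \<in> perfect_matchings (?V - ?G t')"
        using s by auto
      have eG: "?G t = ?G t'" and eI: "insert (?G t) M = insert (?G t') M'"
        using e unfolding st prod.case prod.inject by (rule conjunct2, rule conjunct1)
      have tt: "t = t'"
      proof -
        obtain a b c a' b' c' where abc: "t = (a, b, c)" "t' = (a', b', c')"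
          by (metis prod_cases3)
        \<comment> \<open>The crossed alternative is contradictory, because in each triple the first
          endpoint is smaller than the second.\<close>
        have "Suc a = Suc a' \<and> a + b + 2 = a' + b' + 2 \<or>
            Suc a = a' + b' + 2 \<and> a + b + 2 = Suc a'"
          using eG by (simp only: abc prod.case doubleton_eq_iff)
        then have "a = a'" "b = b'" by linarith+
        moreover have "c = c'" using t calculation by (simp add: abc compositions3_def)
        ultimately show ?thesis by (simp add: abc)
      qed
      have "?G t \<notin> M" "?G t' \<notin> M'"
        by (rule perfect_matchings_insert(2)[OF M(1) G[OF t(1)]],
            rule perfect_matchings_insert(2)[OF M(2) G[OF t(2)]])
      then have "M = M'" using eI unfolding tt by (rule iffD1[OF insert_ident])
      then show "s = s'" using st tt by simp
    qed
    show "(\<lambda>(t, M). (insert (?G t) M, ?G t)) ` ?S = configurations n"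
    proof (intro equalityI subsetI)
      fix x assume "x \<in> (\<lambda>(t, M). (insert (?G t) M, ?G t)) ` ?S"
      then obtain t M where x: "x = (insert (?G t) M, ?G t)" "t \<in> ?T"
        "M \<in> perfect_matchings (?V - ?G t)" by auto
      then show "x \<in> configurations n"
        using perfect_matchings_insert(1)[OF x(3) G[OF x(2)]] by (auto simp: configurations_def)
    next
      fix x assume "x \<in> configurations n"
      then obtain M H where x: "x = (M, H)" "M \<in> perfect_matchings ?V" "H \<in> M"
        by (auto simp: configurations_def)
      note P = perfect_matchings_Diff[OF x(2,3)]
      obtain g h where gh: "H = {g, h}" "g < h"
        using P(3) by (metis card_2_iff insert_commute linorder_neqE_nat)
      \<comment> \<open>The numbers of points to the left of \<open>g\<close>, strictly between
        \<open>g\<close> and \<open>h\<close>, and to the right of \<open>h\<close>.\<close>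
      define t where "t = (g - 1, h - g - 1, 2 * n - h)"
      have t: "t \<in> ?T" "?G t = H"
        using gh P(2) by (auto simp: t_def compositions3_def)
      have "(t, M - {H}) \<in> ?S" using P(1) t by simp
      moreover have "x = (insert (?G t) (M - {H}), ?G t)"
        unfolding t(2) using x by auto
      ultimately show "x \<in> (\<lambda>(t, M). (insert (?G t) M, ?G t)) ` ?S"
        by (intro rev_image_eqI[of "(t, M - {H})"]) simp_all
    qed
  qed
  then have "(\<Sum>c\<in>configurations n. y ^ num_excluded c) =
      (\<Sum>s\<in>?S. y ^ num_excluded ((\<lambda>(t, M). (insert (?G t) M, ?G t)) s))"
    by (rule sum.reindex_bij_betw[symmetric])
  also have "\<dots> = (\<Sum>(t, M)\<in>?S. y ^ num_excluded (insert (?G t) M, ?G t))"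
    by (rule sum.cong) auto
  also have "\<dots> = (\<Sum>t\<in>?T. \<Sum>M\<in>perfect_matchings (?V - ?G t).
      y ^ num_excluded (insert (?G t) M, ?G t))"
    by (rule sum.Sigma[symmetric])
      (auto intro: finite_perfect_matchings simp: finite_compositions3)
  also have "\<dots> = (\<Sum>(a, b, c)\<in>?T. three_part_weight y a b c)"
  proof (rule sum.cong[OF refl], clarify)
    fix a b c assume t: "(a, b, c) \<in> ?T"
    let ?H = "{Suc a, a + b + 2}"
    let ?L = "{1..a}" and ?R = "{a + b + 3..2 * n}" and ?B = "{a + 2..a + b + 1}"
    have V: "?V - ?H = ?L \<union> ?B \<union> ?R"
      using t assms by (auto simp: compositions3_def)
    have "num_excluded (insert ?H M, ?H) = card {P \<in> M. P \<subseteq> ?L \<or> P \<subseteq> ?R}"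
      if M: "M \<in> perfect_matchings (?V - ?H)" for M
    proof -
      have nin: "?H \<notin> M"
        using perfect_matchings_insert(2)[OF M] G[OF t] by auto
      have "excluded_by ?H P \<longleftrightarrow> P \<subseteq> ?L \<or> P \<subseteq> ?R" if "P \<in> M" for P
      proof -
        have P: "P \<subseteq> ?V" "card P = 2"
          using M that by (auto simp: perfect_matchings_def partition_on_def)
        then have fin: "finite P" "P \<noteq> {}" by (auto intro: card_ge_0_finite)
        have "x < Suc a \<longleftrightarrow> x \<in> ?L" "x > a + b + 2 \<longleftrightarrow> x \<in> ?R" if "x \<in> P" for x
          using P(1) that by auto
        \<comment> \<open>Exclusion compares only extreme points, but a bound on the maximum or
          minimum is a bound on every point, hence containment in an outer block.\<close>
        then have "Max P < Suc a \<longleftrightarrow> P \<subseteq> ?L" "Min P > a + b + 2 \<longleftrightarrow> P \<subseteq> ?R"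
          unfolding Max_less_iff[OF fin] Min_gr_iff[OF fin] subset_eq by blast+
        moreover have "Min ?H = Suc a" "Max ?H = a + b + 2" by auto
        ultimately show ?thesis by (simp only: excluded_by_def)
      qed
      then have "{P \<in> insert ?H M - {?H}. excluded_by ?H P} = {P \<in> M. P \<subseteq> ?L \<or> P \<subseteq> ?R}"
        using nin by auto
      then show ?thesis by (simp only: num_excluded_def prod.case)
    qed
    then have "(\<Sum>M\<in>perfect_matchings (?V - ?H). y ^ num_excluded (insert ?H M, ?H)) =
        matching_weight y ?L ?B ?R"
      unfolding matching_weight_def V by (intro sum.cong) auto
    also have "\<dots> = three_part_weight y a b c"
    proof (subst matching_weight_eq)
      have "2 * n - (a + b + 2) = c"
        using t assms by (auto simp: compositions3_def)
      then show "three_part_weight y (card ?L) (card ?B) (card ?R) = three_part_weight y a b c"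
        by (simp add: numeral_3_eq_3)
    qed auto
    finally show "(\<Sum>M\<in>perfect_matchings (?V - ?H). y ^ num_excluded (insert ?H M, ?H)) =
        three_part_weight y a b c" .
  qed
  finally show ?thesis .
qed

lemma finite_configurations: "finite (configurations n)"
proof (rule finite_subset)
  show "configurations n \<subseteq> perfect_matchings {1..2 * n} \<times> Pow {1..2 * n}"
    by (auto simp: configurations_def perfect_matchings_def partition_on_def)
qed (auto intro: finite_perfect_matchings)

text \<open>A matching of \<open>2 * n\<close> points has \<open>n\<close> pairs, and the given pair
  is not counted. Hence the range \<open>0..n - 1\<close> of exponents captures every
  configuration.\<close>

lemma num_excluded_le:
  assumes "c \<in> configurations n"
  shows "num_excluded c \<le> n - 1"
proof -
  obtain M G where c: "c = (M, G)" "M \<in> perfect_matchings {1..2 * n}" "G \<in> M"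
    using assms by (auto simp: configurations_def)
  have fin: "finite M" by (rule perfect_matching_finite[OF _ c(2)]) simp
  have "card M = n" using card_perfect_matching[OF _ c(2)] by simp
  moreover have "num_excluded c \<le> card (M - {G})"
    unfolding c num_excluded_def by (auto intro: card_mono fin)
  ultimately show ?thesis using c fin by simp
qed

text \<open>Grouping the configurations by their number of excluded pairs turns the polynomial in
  \<open>y\<close> into a sum over configurations.\<close>

lemma sum_X_count:
  assumes "n \<ge> 1"
  shows "(\<Sum>p = 0..n - 1. of_nat (X_count n p) * y ^ p) =
    (\<Sum>(a, b, c)\<in>compositions3 (2 * n - 2). three_part_weight (y::'a::comm_semiring_1) a b c)"
proof -
  have "(\<Sum>c\<in>configurations n. y ^ num_excluded c) =
      (\<Sum>p = 0..n - 1. \<Sum>c | c \<in> configurations n \<and> num_excluded c = p. y ^ num_excluded c)"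
    by (rule sum.group[symmetric]) (auto simp: finite_configurations dest: num_excluded_le)
  also have "\<dots> = (\<Sum>p = 0..n - 1. of_nat (X_count n p) * y ^ p)"
    by (intro sum.cong refl) (simp add: X_count_def)
  finally show ?thesis using sum_power_num_excluded[OF assms, of y] by simp
qed

section \<open>Recurrences for the total weight and for adjacent endpoints\<close>

text \<open>Terms whose distinguished part is 0 vanish because of the factor; on the others,
  lowering that part by one is a bijection onto the triples with sum \<open>N\<close>.\<close>

lemma sum_compositions3_Suc:
  fixes f :: "nat \<Rightarrow> nat \<Rightarrow> nat \<Rightarrow> 'a::comm_semiring_1"
  shows "(\<Sum>(a, b, c)\<in>compositions3 (N + 1). of_nat a * f (a - 1) b c) =
      (\<Sum>(a, b, c)\<in>compositions3 N. of_nat (Suc a) * f a b c)"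
      (is "?s1 = ?t1")
    and "(\<Sum>(a, b, c)\<in>compositions3 (N + 1). of_nat b * f a (b - 1) c) =
      (\<Sum>(a, b, c)\<in>compositions3 N. of_nat (Suc b) * f a b c)"
      (is "?s2 = ?t2")
    and "(\<Sum>(a, b, c)\<in>compositions3 (N + 1). of_nat c * f a b (c - 1)) =
      (\<Sum>(a, b, c)\<in>compositions3 N. of_nat (Suc c) * f a b c)"
      (is "?s3 = ?t3")
proof -
  have "?s1 = (\<Sum>(a, b, c)\<in>{t \<in> compositions3 (N + 1). fst t \<noteq> 0}. of_nat a * f (a - 1) b c)"
    by (rule sum.mono_neutral_right) (auto simp: finite_compositions3 intro!: gr0I)
  also have "\<dots> = ?t1"
    by (rule sum.reindex_bij_witness[of _ "\<lambda>(a, b, c). (Suc a, b, c)" "\<lambda>(a, b, c). (a - 1, b, c)"])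
      (auto simp: compositions3_def simp del: of_nat_Suc)
  finally show "?s1 = ?t1" .
next
  have "?s2 = (\<Sum>(a, b, c)\<in>{t \<in> compositions3 (N + 1). fst (snd t) \<noteq> 0}. of_nat b * f a (b - 1) c)"
    by (rule sum.mono_neutral_right) (auto simp: finite_compositions3 intro!: gr0I)
  also have "\<dots> = ?t2"
    by (rule sum.reindex_bij_witness[of _ "\<lambda>(a, b, c). (a, Suc b, c)" "\<lambda>(a, b, c). (a, b - 1, c)"])
      (auto simp: compositions3_def simp del: of_nat_Suc)
  finally show "?s2 = ?t2" .
next
  have "?s3 = (\<Sum>(a, b, c)\<in>{t \<in> compositions3 (N + 1). snd (snd t) \<noteq> 0}. of_nat c * f a b (c - 1))"
    by (rule sum.mono_neutral_right) (auto simp: finite_compositions3 intro!: gr0I)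
  also have "\<dots> = ?t3"
    by (rule sum.reindex_bij_witness[of _ "\<lambda>(a, b, c). (a, b, Suc c)" "\<lambda>(a, b, c). (a, b, c - 1)"])
      (auto simp: compositions3_def simp del: of_nat_Suc)
  finally show "?s3 = ?t3" .
qed

text \<open>The index \<open>N\<close> counts the points outside the given pair, so
  \<open>total_weight y (2 * n)\<close> belongs to configurations of size
  \<open>n + 1\<close>.\<close>

definition total_weight :: "'a::comm_ring_1 \<Rightarrow> nat \<Rightarrow> 'a" where
  "total_weight y N = (\<Sum>(a, b, c)\<in>compositions3 N. three_part_weight y a b c)"

text \<open>The contribution of given pairs with adjacent endpoints, which cut the other
  \<open>N\<close> points into a left and a right block.\<close>

definition cut_weight :: "'a::comm_ring_1 \<Rightarrow> nat \<Rightarrow> 'a" where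
  "cut_weight y N = (\<Sum>a\<le>N. three_part_weight y a 0 (N - a))"

text \<open>Remove a point between the endpoints of the given pair, if there is one, together with its
  partner. This pair is not excluded, and summing over the three parts in which the partner can
  lie, the numbers of positions at which it can be put back add up to \<open>N + 3\<close>.\<close>

lemma total_weight_rec:
  "total_weight y (N + 2) = of_nat (N + 3) * total_weight y N + cut_weight y (N + 2)"
proof -
  let ?w = "three_part_weight y"
  let ?T = "compositions3"
  have split: "?T (N + 2) = {t \<in> ?T (N + 2). fst (snd t) = 0} \<union> {t \<in> ?T (N + 2). fst (snd t) \<noteq> 0}"
    by auto
  have "total_weight y (N + 2) = (\<Sum>(a, b, c)\<in>{t \<in> ?T (N + 2). fst (snd t) = 0}. ?w a b c) +
      (\<Sum>(a, b, c)\<in>{t \<in> ?T (N + 2). fst (snd t) \<noteq> 0}. ?w a b c)"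
    unfolding total_weight_def
    by (subst split, rule sum.union_disjoint) (auto intro: finite_subset[OF _ finite_compositions3])
  also have "(\<Sum>(a, b, c)\<in>{t \<in> ?T (N + 2). fst (snd t) = 0}. ?w a b c) = cut_weight y (N + 2)"
    unfolding cut_weight_def
    by (rule sum.reindex_bij_witness[of _ "\<lambda>a. (a, 0, N + 2 - a)" fst])
      (auto simp: compositions3_def intro!: arg_cong[of _ _ "three_part_weight y _ 0"])
  \<comment> \<open>Shifting the middle part by one exposes a \<open>Suc\<close>, so that the first
    equation of \<open>three_part_weight\<close> applies.\<close>
  also have "(\<Sum>(a, b, c)\<in>{t \<in> ?T (N + 2). fst (snd t) \<noteq> 0}. ?w a b c) =
      (\<Sum>(a, b, c)\<in>?T (N + 1). ?w a (Suc b) c)"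
    by (rule sum.reindex_bij_witness[of _ "\<lambda>(a, b, c). (a, Suc b, c)" "\<lambda>(a, b, c). (a, b - 1, c)"])
      (auto simp: compositions3_def simp del: three_part_weight.simps)
  also have "\<dots> = (\<Sum>(a, b, c)\<in>?T (N + 1). of_nat b * ?w a (b - 1) c) +
      (\<Sum>(a, b, c)\<in>?T (N + 1). of_nat a * ?w (a - 1) b c) +
      (\<Sum>(a, b, c)\<in>?T (N + 1). of_nat c * ?w a b (c - 1))"
    by (simp add: case_prod_unfold sum.distrib)
  also have "(\<Sum>(a, b, c)\<in>?T (N + 1). of_nat b * ?w a (b - 1) c) =
      (\<Sum>(a, b, c)\<in>?T N. of_nat (Suc b) * ?w a b c)"
    by (rule sum_compositions3_Suc(2))
  also have "(\<Sum>(a, b, c)\<in>?T (N + 1). of_nat a * ?w (a - 1) b c) =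
      (\<Sum>(a, b, c)\<in>?T N. of_nat (Suc a) * ?w a b c)"
    by (rule sum_compositions3_Suc(1))
  also have "(\<Sum>(a, b, c)\<in>?T (N + 1). of_nat c * ?w a b (c - 1)) =
      (\<Sum>(a, b, c)\<in>?T N. of_nat (Suc c) * ?w a b c)"
    by (rule sum_compositions3_Suc(3))
  also have "(\<Sum>(a, b, c)\<in>?T N. of_nat (Suc b) * ?w a b c) +
      (\<Sum>(a, b, c)\<in>?T N. of_nat (Suc a) * ?w a b c) +
      (\<Sum>(a, b, c)\<in>?T N. of_nat (Suc c) * ?w a b c) =
      (\<Sum>(a, b, c)\<in>?T N. of_nat (N + 3) * ?w a b c)"
    unfolding sum.distrib[symmetric]
  proof (rule sum.cong[OF refl], clarify)
    fix a b c assume "(a, b, c) \<in> ?T N"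
    then have "N + 3 = Suc b + Suc a + Suc c" by (auto simp: compositions3_def)
    then show "of_nat (Suc b) * ?w a b c + of_nat (Suc a) * ?w a b c + of_nat (Suc c) * ?w a b c =
        of_nat (N + 3) * ?w a b c"
      by (simp only: of_nat_add distrib_right)
  qed
  also have "\<dots> = of_nat (N + 3) * total_weight y N"
    by (simp add: total_weight_def sum_distrib_left case_prod_unfold)
  finally show ?thesis by (simp only: add.commute)
qed

text \<open>For a nonempty left block, remove one of its points. Partners on the left give
  \<open>y\<close> times \<open>?A\<close>, partners on the right give \<open>?C\<close>. Reflection
  shows \<open>?A = ?C\<close>, and the coefficients in \<open>?A + ?C\<close> add up to
  \<open>2 * Suc n\<close>, so each equals \<open>Suc n\<close> times the previous weight. The last
  summand is the case of an empty left block.\<close>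

lemma cut_weight_rec:
  fixes y :: "'a::field_char_0"
  shows "cut_weight y (2 * Suc n) =
    of_nat (Suc n) * (1 + y) * cut_weight y (2 * n) + three_part_weight y 0 0 (2 * Suc n)"
proof -
  let ?w = "\<lambda>a c. three_part_weight y a 0 c"
  let ?N = "2 * n"
  let ?A = "\<Sum>a\<le>?N. of_nat (Suc a) * ?w a (?N - a)"
  let ?C = "\<Sum>a\<le>?N. of_nat (Suc (?N - a)) * ?w a (?N - a)"
  have "?C = (\<Sum>a\<le>?N. of_nat (Suc a) * ?w (?N - a) a)"
    by (rule sum.reindex_bij_witness[of _ "\<lambda>a. ?N - a" "\<lambda>a. ?N - a"]) auto
  then have CA: "?C = ?A"
    by (simp add: three_part_weight_commute[of y _ 0])
  have "?A + ?C = (\<Sum>a\<le>?N. of_nat (2 * Suc n) * ?w a (?N - a))"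
    unfolding sum.distrib[symmetric] distrib_right[symmetric] of_nat_add[symmetric]
    by (intro sum.cong refl) simp
  then have "2 * ?A = 2 * (of_nat (Suc n) * cut_weight y ?N)"
    unfolding CA cut_weight_def
    by (simp only: sum_distrib_left[symmetric] of_nat_mult mult_2[symmetric] mult.assoc of_nat_numeral)
  then have A: "?A = of_nat (Suc n) * cut_weight y ?N"
    by simp
  have "cut_weight y (2 * Suc n) = ?w 0 (2 * Suc n) + (\<Sum>a\<le>Suc ?N. ?w (Suc a) (Suc ?N - a))"
    unfolding cut_weight_def
    using sum.atMost_Suc_shift[of "\<lambda>a. ?w a (2 * Suc n - a)" "Suc ?N"]
    by (simp del: sum.atMost_Suc three_part_weight.simps)
  also have "(\<Sum>a\<le>Suc ?N. ?w (Suc a) (Suc ?N - a)) =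
      (\<Sum>a\<le>Suc ?N. y * (of_nat a * ?w (a - 1) (Suc ?N - a))) +
      (\<Sum>a\<le>Suc ?N. of_nat (Suc ?N - a) * ?w a (Suc ?N - a - 1))"
    by (simp add: sum.distrib mult.assoc)
  also have "(\<Sum>a\<le>Suc ?N. y * (of_nat a * ?w (a - 1) (Suc ?N - a))) = y * ?A"
    by (simp add: sum.atMost_Suc_shift sum_distrib_left del: sum.atMost_Suc)
  \<comment> \<open>At \<open>a = Suc ?N\<close> the right block is empty and the coefficient is 0,
    so the range ends at \<open>?N\<close>.\<close>
  also have "(\<Sum>a\<le>Suc ?N. of_nat (Suc ?N - a) * ?w a (Suc ?N - a - 1)) =
      (\<Sum>a\<le>?N. of_nat (Suc ?N - a) * ?w a (Suc ?N - a - 1))"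
    by (simp only: sum.atMost_Suc diff_self_eq_0 of_nat_0 mult_zero_left add_0_right)
  also have "\<dots> = ?C"
    by (rule sum.cong[OF refl]) (simp only: atMost_iff Suc_diff_le diff_Suc_1)
  finally show ?thesis unfolding CA A by (simp add: algebra_simps)
qed

lemma total_weight_0: "total_weight y 0 = 1"
proof -
  have "compositions3 0 = {(0, 0, 0)}" by (auto simp: compositions3_def)
  then show ?thesis by (simp add: total_weight_def)
qed

lemma cut_weight_0: "cut_weight y 0 = 1"
  by (simp add: cut_weight_def)

section \<open>Square root and arctangent of formal power series\<close>

text \<open>Formal power series over a field form an integral domain, so a square has only the roots
  \<open>f\<close> and \<open>- f\<close>; the constant coefficient rules out
  \<open>- f\<close>.\<close>

lemma fps_sqrt1_unique:
  assumes "f ^ 2 = g" "fps_nth f 0 = 1"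
  shows "fps_sqrt1 g = f"
proof -
  have "fps_nth g 0 = 1"
    using assms by (auto simp: power2_eq_square)
  then have "fps_sqrt1 g ^ 2 = f ^ 2"
    using assms(1) fps_sqrt1_power2 by simp
  then have "fps_sqrt1 g = f \<or> fps_sqrt1 g = - f"
    by (simp add: power2_eq_iff)
  moreover have "fps_sqrt1 g \<noteq> - f"
  proof
    assume "fps_sqrt1 g = - f"
    then have "fps_nth (fps_sqrt1 g) 0 = - fps_nth f 0" by simp
    then show False using assms(2) by (simp add: fps_sqrt1_nth_0)
  qed
  ultimately show ?thesis by blast
qed

lemma fps_sqrt1_mult:
  assumes "fps_nth f 0 = 1" "fps_nth g 0 = 1"
  shows "fps_sqrt1 (f * g) = fps_sqrt1 f * fps_sqrt1 g"
  by (rule fps_sqrt1_unique)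
    (simp_all add: power_mult_distrib fps_sqrt1_power2 fps_sqrt1_nth_0 assms)

lemma fps_sqrt1_deriv:
  assumes "fps_nth f 0 = 1"
  shows "2 * fps_sqrt1 f * fps_deriv (fps_sqrt1 f) = fps_deriv f"
proof -
  have "fps_deriv (fps_sqrt1 f * fps_sqrt1 f) = fps_deriv f"
    using fps_sqrt1_power2[OF assms] by (simp add: power2_eq_square)
  then show ?thesis by (simp add: algebra_simps)
qed

lemma fps_arctan_nth_0: "fps_nth fps_arctan 0 = 0"
  by (simp add: fps_arctan_def fps_inv_def)

text \<open>The tangent satisfies \<open>t' = 1 + t ^ 2\<close>; the chain rule applied to
  \<open>tan oo arctan = X\<close> then gives the claim.\<close>

lemma fps_arctan_deriv: "(1 + fps_X ^ 2) * fps_deriv (fps_arctan :: 'a::field_char_0 fps) = 1"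
proof -
  let ?c = "fps_cos (1::'a)" and ?s = "fps_sin (1::'a)" and ?t = "fps_tan (1::'a)"
  have c: "fps_nth ?c 0 = 1" by (simp add: fps_cos_def)
  then have c0: "?c \<noteq> 0" by (metis fps_zero_nth zero_neq_one)
  have tc: "?t * ?c = ?s"
    unfolding fps_tan_def using c by (simp add: fps_divide_unit mult.assoc inverse_mult_eq_1)
  have "fps_deriv ?t * ?c ^ 2 = 1"
  proof -
    have "fps_deriv ?t = 1 / ?c ^ 2" by (simp add: fps_tan_deriv)
    moreover have "fps_nth (?c ^ 2) 0 \<noteq> 0" using c by (simp add: power2_eq_square)
    ultimately show ?thesis
      by (simp add: fps_divide_unit inverse_mult_eq_1)
  qed
  moreover have "(1 + ?t ^ 2) * ?c ^ 2 = 1"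
  proof -
    have "(1 + ?t ^ 2) * ?c ^ 2 = ?c ^ 2 + (?t * ?c) ^ 2"
      by (simp add: algebra_simps power_mult_distrib)
    also have "\<dots> = 1" using fps_sin_cos_sum_of_squares[of "1::'a"] by (simp add: tc)
    finally show ?thesis .
  qed
  \<comment> \<open>Both sides become 1 after multiplication by the nonzero series
    \<open>?c ^ 2\<close>.\<close>
  ultimately have t': "fps_deriv ?t = 1 + ?t ^ 2"
    using c0 by (metis mult_right_cancel power_not_zero)
  have "fps_deriv (?t oo fps_arctan) = (fps_deriv ?t oo fps_arctan) * fps_deriv fps_arctan"
    by (rule fps_compose_deriv[OF fps_arctan_nth_0])
  also have "fps_deriv ?t oo fps_arctan = 1 + (?t oo fps_arctan) ^ 2"
    unfolding t' by (simp add: fps_compose_add_distrib fps_compose_power[OF fps_arctan_nth_0])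
  finally show ?thesis by (simp add: fps_tan_compose_arctan)
qed

section \<open>The differential equation of the closed form\<close>

text \<open>Write the closed form as \<open>k * S * F = arctan oo B\<close> with
  \<open>B = k * X / T\<close>. Differentiating the right side gives \<open>D = k / (T * U)\<close>,
  because \<open>1 + B * B = U * U / Q\<close>. Differentiating the left side gives
  \<open>S * D = k * (P * F' - F)\<close>. Comparing the two with \<open>T = S * R\<close> yields
  the equation.\<close>

lemma closed_form_ode:
  fixes y :: "'a::field_char_0"
  assumes "y \<noteq> 1"
  defines "F \<equiv> 1 / (fps_const (1 - y) * fps_sqrt1 (1 - 2 * fps_X)) *
    (fps_arctan oo
      (fps_const (1 - y) * fps_X /
        fps_sqrt1 ((1 - 2 * fps_X) * (1 - 2 * fps_const y * fps_X))))"
  shows "fps_sqrt1 (1 - 2 * fps_const y * fps_X) * (1 - fps_const (1 + y) * fps_X) *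
    ((1 - 2 * fps_X) * fps_deriv F - F) = 1" and "fps_nth F 0 = 0"
proof -
  define P where "P = 1 - 2 * (fps_X :: 'a fps)"
  define R where "R = fps_sqrt1 (1 - 2 * fps_const y * fps_X)"
  define S where "S = fps_sqrt1 P"
  define T where "T = S * R"
  define k where "k = fps_const (1 - y)"
  define U where "U = 1 - fps_const (1 + y) * fps_X"
  define Q where "Q = P * (1 - 2 * fps_const y * fps_X)"
  define B where "B = k * fps_X / T"
  define D where "D = fps_deriv (fps_arctan oo B)"
  have P0: "fps_nth P 0 = 1" by (simp add: P_def)
  have y0: "fps_nth (1 - 2 * fps_const y * fps_X) 0 = 1" by simp
  have T_eq: "fps_sqrt1 Q = T"
    unfolding Q_def T_def S_def R_def by (rule fps_sqrt1_mult[OF P0 y0])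
  have T0: "fps_nth T 0 = 1" and S0: "fps_nth S 0 = 1" and R0: "fps_nth R 0 = 1"
    by (simp_all add: T_def S_def R_def fps_sqrt1_nth_0)
  have nz: "T \<noteq> 0" "S \<noteq> 0" "R \<noteq> 0" using T0 S0 R0 by auto
  have Q0: "fps_nth Q 0 = 1" using P0 by (simp add: Q_def)
  have TT: "T * T = Q" using fps_sqrt1_power2[OF Q0] by (simp add: T_eq power2_eq_square)
  have T': "2 * T * fps_deriv T = fps_deriv Q" using fps_sqrt1_deriv[OF Q0] by (simp add: T_eq)
  have SS: "S * S = P" using fps_sqrt1_power2[OF P0] by (simp add: S_def power2_eq_square)
  have "2 * S * fps_deriv S = 2 * (- 1)"
    using fps_sqrt1_deriv[OF P0] by (simp add: S_def P_def fps_deriv_mult)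
  then have S': "S * fps_deriv S = - 1"
    by (metis mult.assoc mult_left_cancel zero_neq_numeral)
  have BT: "B * T = k * fps_X"
    unfolding B_def using T0 by (simp add: fps_divide_unit mult.assoc inverse_mult_eq_1)
  have B0: "fps_nth B 0 = 0"
  proof -
    have "fps_nth (B * T) 0 = 0" unfolding BT by simp
    then show ?thesis using T0 by simp
  qed
  have k: "k \<noteq> 0" "k = 1 - fps_const y" using assms(1) by (auto simp: k_def simp flip: fps_const_sub)
  have U: "U = 1 - (1 + fps_const y) * fps_X" "U \<noteq> 0"
  proof -
    have "fps_nth U 0 = 1" by (simp add: U_def)
    then show "U \<noteq> 0" by auto
  qed (simp add: U_def flip: fps_const_add)
  have Q_eq: "Q = (1 - 2 * fps_X) * (1 - 2 * fps_const y * fps_X)" by (simp add: Q_def P_def)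
  \<comment> \<open>This perfect square is what makes the derivative of the arctangent simple: the
    denominator becomes the square of a linear polynomial.\<close>
  have U2: "Q + k * k * fps_X * fps_X = U * U"
    unfolding k U Q_eq by (simp add: algebra_simps)
  have Q': "fps_deriv Q = - 2 * (1 + fps_const y) + 8 * fps_const y * fps_X"
    unfolding Q_eq by (simp add: algebra_simps fps_deriv_mult)
  have B': "fps_deriv B * T + B * fps_deriv T = k"
  proof -
    have "fps_deriv (B * T) = k" unfolding BT by (simp add: k_def)
    then show ?thesis by (simp add: algebra_simps)
  qed
  have D: "(1 + B * B) * D = fps_deriv B"
  proof -
    have "((1 + fps_X ^ 2) * fps_deriv fps_arctan) oo B = 1"
      by (simp add: fps_arctan_deriv)
    then have "(1 + B ^ 2) * (fps_deriv fps_arctan oo B) = 1"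
      by (simp add: fps_compose_mult_distrib[OF B0] fps_compose_add_distrib
          fps_X_power_compose[OF B0] B0)
    moreover have "D = (fps_deriv fps_arctan oo B) * fps_deriv B"
      unfolding D_def by (rule fps_compose_deriv[OF B0])
    ultimately show ?thesis by (simp add: power2_eq_square mult.assoc[symmetric])
  qed
  have TUD: "T * U * D = k"
  proof -
    \<comment> \<open>Multiplying by powers of \<open>T\<close> clears all fractions, leaving only
      \<open>T * T = Q\<close> and \<open>B * T = k * X\<close>.\<close>
    have "T * (T * T + (B * T) * (B * T)) * D = T * T * T * ((1 + B * B) * D)"
      by (simp add: algebra_simps)
    also have "\<dots> = T * T * T * fps_deriv B" by (simp only: D)
    also have "\<dots> = T * T * (fps_deriv B * T)" by (simp add: algebra_simps)
    also have "fps_deriv B * T = k - B * fps_deriv T" using B' by (simp add: eq_diff_eq)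
    finally have TB: "T * (T * T + (B * T) * (B * T)) * D = T * T * (k - B * fps_deriv T)" .
    \<comment> \<open>Doubling brings in \<open>2 * T * T'\<close>, which is the polynomial
      \<open>Q'\<close>.\<close>
    have "2 * (T * (T * T + (B * T) * (B * T)) * D) =
        2 * (T * T) * k - (B * T) * (2 * T * fps_deriv T)"
      unfolding TB by (simp add: algebra_simps)
    then have "2 * (T * (Q + (k * fps_X) * (k * fps_X)) * D) = 2 * Q * k - (k * fps_X) * fps_deriv Q"
      by (simp only: TT BT T')
    moreover have "Q + (k * fps_X) * (k * fps_X) = U * U" using U2 by (simp add: algebra_simps)
    \<comment> \<open>The quadratic terms of \<open>2 * Q\<close> and \<open>X * Q'\<close> cancel,
      leaving twice the linear polynomial \<open>U\<close>; one factor \<open>U\<close> can then be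
      cancelled.\<close>
    moreover have "2 * Q * k - (k * fps_X) * fps_deriv Q = 2 * (k * U)"
      unfolding Q' Q_eq U by (simp add: algebra_simps)
    ultimately have "2 * (T * (U * U) * D) = 2 * (k * U)" by simp
    then have "U * (T * U * D) = U * k" by (simp add: algebra_simps)
    then show ?thesis using U by simp
  qed
  have F: "F = 1 / (k * S) * (fps_arctan oo B)"
    unfolding F_def B_def T_eq[symmetric] Q_def S_def k_def P_def ..
  have kS0: "fps_nth (k * S) 0 \<noteq> 0" using assms(1) S0 by (simp add: k_def)
  have FA: "k * S * F = fps_arctan oo B"
  proof -
    have "k * S * F = inverse (k * S) * (k * S) * (fps_arctan oo B)"
      unfolding F using kS0 by (simp add: fps_divide_unit ac_simps)
    also have "inverse (k * S) * (k * S) = 1" by (rule inverse_mult_eq_1[OF kS0])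
    finally show ?thesis by simp
  qed
  have "fps_nth (k * S * F) 0 = 0"
    unfolding FA by (simp add: fps_arctan_nth_0)
  then show "fps_nth F 0 = 0" using kS0 by simp
  have k': "fps_deriv k = 0" by (simp add: k_def)
  have "D = k * fps_deriv S * F + k * S * fps_deriv F"
    unfolding D_def FA[symmetric] by (simp add: k' algebra_simps)
  \<comment> \<open>The factor \<open>S\<close> turns \<open>S * S'\<close> into \<open>- 1\<close>
    and \<open>S * S\<close> into \<open>P\<close>, so no square root is left on the right.\<close>
  then have "S * D = k * (S * fps_deriv S) * F + k * (S * S) * fps_deriv F"
    by (simp add: algebra_simps)
  then have SD: "S * D = k * (P * fps_deriv F - F)"
    unfolding SS S' by (simp add: algebra_simps)
  have "k * (R * U * (P * fps_deriv F - F)) = R * U * (S * D)"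
    unfolding SD by (simp add: algebra_simps)
  also have "\<dots> = k * 1"
    using TUD by (simp add: T_def algebra_simps)
  finally have "R * U * (P * fps_deriv F - F) = 1"
    using k(1) by (metis mult_left_cancel)
  then show "fps_sqrt1 (1 - 2 * fps_const y * fps_X) * (1 - fps_const (1 + y) * fps_X) *
    ((1 - 2 * fps_X) * fps_deriv F - F) = 1"
    by (simp add: R_def U_def P_def)
qed

section \<open>The differential equation of the generating function\<close>

lemma X_gf_nth_Suc: "fps_nth (X_gf y) (Suc n) = total_weight y (2 * n) / fact (Suc n)"
  using sum_X_count[of "Suc n" y] by (simp add: X_gf_def total_weight_def del: fact_Suc)

lemma fps_mult_1_minus_X_nth:
  fixes c :: "'a::comm_ring_1"
  shows "fps_nth ((1 - fps_const c * fps_X) * f) n =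
    fps_nth f n - (if n = 0 then 0 else c * fps_nth f (n - 1))"
  by (simp add: algebra_simps mult.assoc)

text \<open>The factors are peeled off one at a time. By \<open>total_weight_rec\<close>,
  \<open>H\<close> is the exponential generating function of \<open>cut_weight y (2 * n)\<close>; by
  \<open>cut_weight_rec\<close>, \<open>E\<close> is that of
  \<open>three_part_weight y 0 0 (2 * n)\<close>, which is \<open>y ^ n\<close> times the product of
  the odd numbers below \<open>2 * n\<close>. So \<open>E\<close> is the binomial series of
  \<open>(1 - 2 * y * z)\<close> to the power \<open>-1/2\<close>, the inverse of
  \<open>R\<close>.\<close>

lemma X_gf_ode:
  fixes y :: "'a::field_char_0"
  shows "fps_sqrt1 (1 - 2 * fps_const y * fps_X) * (1 - fps_const (1 + y) * fps_X) *
    ((1 - 2 * fps_X) * fps_deriv (X_gf y) - X_gf y) = 1"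
proof -
  define R where "R = fps_sqrt1 (1 - 2 * fps_const y * fps_X)"
  define H where "H = (1 - 2 * fps_X) * fps_deriv (X_gf y) - X_gf y"
  define E where "E = (1 - fps_const (1 + y) * fps_X) * H"
  have c2: "2 = fps_const (2::'a)" by (rule numeral_fps_const)
  have H: "fps_nth H n = cut_weight y (2 * n) / fact n" for n
  proof (cases n)
    case 0
    have "fps_nth (X_gf y) 0 = 0" by (simp add: X_gf_def)
    then show ?thesis
      unfolding H_def 0 c2
      by (simp add: fps_mult_1_minus_X_nth X_gf_nth_Suc[of y 0, simplified] total_weight_0 cut_weight_0)
  next
    case (Suc m)
    have "fps_nth H n = of_nat (Suc n) * fps_nth (X_gf y) (Suc n)
        - 2 * (of_nat n * fps_nth (X_gf y) n) - fps_nth (X_gf y) n"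
      unfolding H_def c2 Suc
      by (simp only: fps_sub_nth fps_mult_1_minus_X_nth fps_deriv_nth) simp
    \<comment> \<open>With \<open>n = m + 1\<close>, the terms \<open>- 2 * n\<close> and
      \<open>- 1\<close> combine to the coefficient \<open>2 * m + 3\<close> of
      \<open>total_weight_rec\<close>.\<close>
    also have "\<dots> = (total_weight y (2 * n) - of_nat (2 * m + 3) * total_weight y (2 * m)) / fact n"
      unfolding Suc X_gf_nth_Suc
      by (simp add: field_simps del: of_nat_Suc) (simp add: algebra_simps)
    also have "total_weight y (2 * n) - of_nat (2 * m + 3) * total_weight y (2 * m) =
        cut_weight y (2 * n)"
      using total_weight_rec[of y "2 * m"] Suc by simp
    finally show ?thesis .
  qed
  have E: "fps_nth E n = three_part_weight y 0 0 (2 * n) / fact n" for n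
  proof (cases n)
    case 0
    then show ?thesis by (simp add: E_def H cut_weight_0)
  next
    case (Suc m)
    have "fps_nth E n = fps_nth H n - (1 + y) * fps_nth H m"
      unfolding E_def fps_mult_1_minus_X_nth Suc by simp
    also have "\<dots> = three_part_weight y 0 0 (2 * n) / fact n"
      unfolding Suc H cut_weight_rec
      by (simp add: field_simps del: of_nat_Suc three_part_weight.simps)
    finally show ?thesis .
  qed
  \<comment> \<open>The one-block recurrence with factor \<open>y * (2 * n + 1)\<close> as a
    differential equation; it identifies \<open>E\<close> without an explicit formula for its
    coefficients.\<close>
  have ode: "(1 - fps_const (2 * y) * fps_X) * fps_deriv E = fps_const y * E"
  proof (rule fps_ext)
    fix n
    have "of_nat (n + 1) * fps_nth E (n + 1) = y * of_nat (2 * n + 1) * fps_nth E n"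
      by (simp add: E field_simps del: of_nat_Suc)
    then show "fps_nth ((1 - fps_const (2 * y) * fps_X) * fps_deriv E) n =
        fps_nth (fps_const y * E) n"
      unfolding fps_mult_1_minus_X_nth
      by (cases n) (simp_all add: algebra_simps)
  qed
  have arg: "1 - 2 * fps_const y * fps_X = 1 - fps_const (2 * y) * fps_X"
    by (simp add: c2)
  have arg0: "fps_nth (1 - fps_const (2 * y) * fps_X) 0 = 1" by simp
  have R0: "fps_nth R 0 = 1" by (simp add: R_def fps_sqrt1_nth_0)
  then have Rnz: "R \<noteq> 0" by auto
  have RR: "R * R = 1 - fps_const (2 * y) * fps_X"
    using fps_sqrt1_power2[OF arg0] by (simp only: R_def arg power2_eq_square)
  have "2 * (R * fps_deriv R) = 2 * (- fps_const y)"
    using fps_sqrt1_deriv[OF arg0] by (simp add: R_def arg c2 mult.assoc)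
  then have R': "R * fps_deriv R = - fps_const y"
    by (metis mult_left_cancel zero_neq_numeral)
  \<comment> \<open>The two summands are \<open>- y * E\<close> and \<open>y * E\<close>, so
    \<open>R * E\<close> is constant.\<close>
  have "R * fps_deriv (R * E) = (R * fps_deriv R) * E + (R * R) * fps_deriv E"
    by (simp add: algebra_simps)
  also have "\<dots> = 0" unfolding R' RR ode by (simp del: fps_const_neg)
  finally have "fps_deriv (R * E) = 0" using Rnz by simp
  then have "R * E = fps_const (fps_nth (R * E) 0)" by (rule iffD1[OF fps_deriv_eq_0_iff])
  also have "fps_nth (R * E) 0 = 1" by (simp add: R0 E)
  finally show ?thesis by (simp add: R_def E_def H_def mult.assoc)
qed

section \<open>Uniqueness of the solution and conclusion\<close>

text \<open>The equation expresses \<open>n + 1\<close> times the next coefficient through the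
  current one, and \<open>n + 1\<close> is invertible in characteristic 0; so all coefficients
  vanish with the first.\<close>

lemma fps_ode_unique_0:
  fixes f :: "'a::field_char_0 fps"
  assumes "(1 - 2 * fps_X) * fps_deriv f = f" "fps_nth f 0 = 0"
  shows "f = 0"
proof (rule fps_ext)
  fix n
  have c2: "2 = fps_const (2::'a)" by (rule numeral_fps_const)
  have step: "of_nat (Suc n) * fps_nth f (Suc n) = (1 + 2 * of_nat n) * fps_nth f n" for n
  proof -
    have "fps_nth ((1 - 2 * fps_X) * fps_deriv f) n = fps_nth f n" using assms(1) by simp
    then show ?thesis
      unfolding c2 fps_mult_1_minus_X_nth
      by (cases n) (simp_all add: algebra_simps)
  qed
  show "fps_nth f n = fps_nth 0 n"
  proof (induction n)
    case (Suc n)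
    then show ?case using step[of n] by (simp del: of_nat_Suc)
  qed (simp add: assms)
qed

theorem theorem24:
  fixes y :: "'a::field_char_0"
  assumes "y \<noteq> 1"
  shows "X_gf y =
    1 / (fps_const (1 - y) * fps_sqrt1 (1 - 2 * fps_X)) *
    (fps_arctan oo
      (fps_const (1 - y) * fps_X /
        fps_sqrt1 ((1 - 2 * fps_X) * (1 - 2 * fps_const y * fps_X))))"
    (is "_ = ?F")
proof -
  let ?K = "fps_sqrt1 (1 - 2 * fps_const y * fps_X) * (1 - fps_const (1 + y) * fps_X)"
  let ?L = "\<lambda>f. (1 - 2 * fps_X) * fps_deriv f - f"
  note F = closed_form_ode[OF assms]
  have "?K * ?L (X_gf y) = ?K * ?L ?F"
    unfolding F(1) X_gf_ode ..
  \<comment> \<open>A product with \<open>?K\<close> equals 1, so \<open>?K\<close> is nonzero and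
    can be cancelled; by linearity the difference of the two series solves the homogeneous
    equation.\<close>
  moreover have "?K \<noteq> 0" using F(1) by (metis mult_zero_left zero_neq_one)
  ultimately have L: "?L (X_gf y) = ?L ?F" by (metis mult_left_cancel)
  have "X_gf y - ?F = 0"
  proof (rule fps_ode_unique_0)
    show "(1 - 2 * fps_X) * fps_deriv (X_gf y - ?F) = X_gf y - ?F"
      using L by (simp add: algebra_simps)
    show "fps_nth (X_gf y - ?F) 0 = 0"
      using F(2) by (simp add: X_gf_def)
  qed
  then show ?thesis by simp
qed

end
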